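(* There is a polynomial-time reduction that maps every instance $\mathcal{I}=(G,R,(A_r)_{r\in R},I,\iota,(A_h)_{h\in I})$ of the Hedonic Refugees Housing problem to an equivalent instance $\mathcal{J}=(G,R,(A'_r)_{r\in R},I,\iota,(A'_h)_{h\in I},(T_i)_{i\in[\tau]})$ of the Diversity Refugees Housing problem with $\tau=|R|+|I|$ types. Here equivalent means that $\mathcal{I}$ is a yes-instance if and only if $\mathcal{J}$ is a yes-instance.
   Context: Common setting: $G=(V,E)$ is a finite simple undirected graph (the topology); $R$ is a finite non-empty set of refugees and $I$ a finite set of inhabitants with $|V|\ge |R|+|I|$; $\mathcal{N}=R\cup I$ (disjoint) is the set of agents; $\iota\colon I\to V$ is injective; $V_I=\iota(I)$, $V_U=V\setminus V_I$. A housing is an injective map $\pi\colon R\to V_U$. Write $[\tau]=\{1,\ldots,\tau\}$. Hedonic Refugees Housing: each $h\in I$ has an approval set $A_h\subseteq 2^R$ and each $r\in R$ an approval set $A_r\subseteq 2^I$; the instance is a yes-instance iff there is a housing $\pi$ with $\{r\in R: \pi(r)\in N_G(\iota(h))\}\in A_h$ for every $h\in I$ and $\{h\in I:\iota(h)\in N_G(\pi(r))\}\in A_r$ for every $r\in R$. Diversity Refugees Housing: $\mathcal{N}$ is partitioned into $\tau$ types $T_1,\ldots,T_\tau$. The palette of a set $S\subseteq\mathcal{N}$ is the $\tau$-tuple $(|T_i\cap S|/|S|)_{i\in[\tau]}$ if $S\neq\emptyset$ and $(0,\ldots,0)$ if $S=\emptyset$. Each agent $a\in\mathcal{N}$ has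 an approval set $A'_a$ that is a subset of the set of palettes of subsets of $\mathcal{N}$. Given a housing $\pi$, the neighborhood of an agent placed on vertex $v$ ($v=\iota(h)$ for $h\in I$, $v=\pi(r)$ for $r\in R$) is the set of all agents (inhabitants and refugees) placed on vertices of $N_G(v)$. The instance is a yes-instance iff there is a housing $\pi$ that is diversity respecting, i.e. for every agent $a$ the palette of $a$'s neighborhood belongs to $A'_a$. Since approval sets may have exponential size, they are not listed explicitly but given as oracles that decide, for a given set (hedonic) or palette (diversity), whether it is approved; the reduction outputs procedures implementing the new oracles, running in polynomial time given access to the oracles of $\mathcal{I}$. *)

theory Defs
  imports Complex_Main
    "HOL-Library.Disjoint_Sets"
    "HOL-Computational_Algebra.Polynomial"
begin

section \<open>Refugees housing\<close>

text \<open>Vertices and agents are named by natural numbers; refugees and inhabitants share one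
  name space, so that their disjointness is a genuine condition. Only the values of \<open>place\<close>
  (the map iota) on inhabitants and of the approval maps on agents are meaningful.\<close>

record setting =
  verts :: "nat set"
  edges :: "nat set set"
  refugees :: "nat set"
  inhabitants :: "nat set"
  place :: "nat \<Rightarrow> nat"

record hedonic = setting +
  approved_sets :: "nat \<Rightarrow> nat set set"

text \<open>\<open>types J ! i\<close> is the type with index i+1, and a palette is a list of rationals with one
  entry for each type.\<close>

record diversity = setting +
  types :: "nat set list"
  approved_palettes :: "nat \<Rightarrow> rat list set"

definition simple_graph :: "nat set \<Rightarrow> nat set set \<Rightarrow> bool" where
  "simple_graph V E \<longleftrightarrow> finite V \<and> (\<forall>e\<in>E. e \<subseteq> V \<and> card e = 2)"

definition nbrs :: "('x) setting_scheme \<Rightarrow> nat \<Rightarrow> nat set" where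
  "nbrs S v = {u \<in> verts S. {u, v} \<in> edges S}"

definition agents :: "('x) setting_scheme \<Rightarrow> nat set" where
  "agents S = refugees S \<union> inhabitants S"

definition wf_setting :: "('x) setting_scheme \<Rightarrow> bool" where
  "wf_setting S \<longleftrightarrow>
     simple_graph (verts S) (edges S) \<and>
     finite (refugees S) \<and> refugees S \<noteq> {} \<and>
     finite (inhabitants S) \<and>
     refugees S \<inter> inhabitants S = {} \<and>
     card (refugees S) + card (inhabitants S) \<le> card (verts S) \<and>
     place S ` inhabitants S \<subseteq> verts S \<and>
     inj_on (place S) (inhabitants S)"

definition free_verts :: "('x) setting_scheme \<Rightarrow> nat set" where
  "free_verts S = verts S - place S ` inhabitants S"

definition housing :: "('x) setting_scheme \<Rightarrow> (nat \<Rightarrow> nat) \<Rightarrow> bool" where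
  "housing S \<pi> \<longleftrightarrow> \<pi> ` refugees S \<subseteq> free_verts S \<and> inj_on \<pi> (refugees S)"

subsection \<open>Hedonic Refugees Housing\<close>

definition hedonic_instance :: "hedonic \<Rightarrow> bool" where
  "hedonic_instance H \<longleftrightarrow>
     wf_setting H \<and>
     (\<forall>h\<in>inhabitants H. approved_sets H h \<subseteq> Pow (refugees H)) \<and>
     (\<forall>r\<in>refugees H. approved_sets H r \<subseteq> Pow (inhabitants H))"

definition hedonic_yes :: "hedonic \<Rightarrow> bool" where
  "hedonic_yes H \<longleftrightarrow> (\<exists>\<pi>. housing H \<pi> \<and>
     (\<forall>h\<in>inhabitants H.
        {r \<in> refugees H. \<pi> r \<in> nbrs H (place H h)} \<in> approved_sets H h) \<and>
     (\<forall>r\<in>refugees H.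
        {h \<in> inhabitants H. place H h \<in> nbrs H (\<pi> r)} \<in> approved_sets H r))"

subsection \<open>Diversity Refugees Housing\<close>

definition palette :: "nat set list \<Rightarrow> nat set \<Rightarrow> rat list" where
  "palette Ts S =
     map (\<lambda>T. if S = {} then 0 else of_nat (card (T \<inter> S)) / of_nat (card S)) Ts"

definition diversity_instance :: "diversity \<Rightarrow> bool" where
  "diversity_instance J \<longleftrightarrow>
     wf_setting J \<and>
     distinct (types J) \<and> partition_on (agents J) (set (types J)) \<and>
     (\<forall>a\<in>agents J. approved_palettes J a \<subseteq> palette (types J) ` Pow (agents J))"

definition position :: "('x) setting_scheme \<Rightarrow> (nat \<Rightarrow> nat) \<Rightarrow> nat \<Rightarrow> nat" where
  "position S \<pi> a = (if a \<in> inhabitants S then place S a else \<pi> a)"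

definition neighborhood :: "('x) setting_scheme \<Rightarrow> (nat \<Rightarrow> nat) \<Rightarrow> nat \<Rightarrow> nat set" where
  "neighborhood S \<pi> a = {b \<in> agents S. position S \<pi> b \<in> nbrs S (position S \<pi> a)}"

definition diversity_respecting :: "diversity \<Rightarrow> (nat \<Rightarrow> nat) \<Rightarrow> bool" where
  "diversity_respecting J \<pi> \<longleftrightarrow>
     (\<forall>a\<in>agents J. palette (types J) (neighborhood J \<pi> a) \<in> approved_palettes J a)"

definition diversity_yes :: "diversity \<Rightarrow> bool" where
  "diversity_yes J \<longleftrightarrow> (\<exists>\<pi>. housing J \<pi> \<and> diversity_respecting J \<pi>)"


section \<open>Polynomial-time computation with an oracle\<close>

text \<open>The machine model is Jones' WHILE language, extended by oracle queries. Data are binary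
  trees. To keep the running time polynomially related to that of Turing machines also for
  function outputs and oracle queries, an expression is charged the total size of all values
  that occur during its evaluation (with unit costs, repeated use of \<open>Node\<close> would build a tree of
  exponential size in linear time). An oracle query is charged the size of the query.\<close>

datatype tree = Leaf | Node tree tree

primrec tsize :: "tree \<Rightarrow> nat" where
  "tsize Leaf = 1"
| "tsize (Node l r) = 1 + tsize l + tsize r"

primrec left :: "tree \<Rightarrow> tree" where
  "left Leaf = Leaf"
| "left (Node l r) = l"

primrec right :: "tree \<Rightarrow> tree" where
  "right Leaf = Leaf"
| "right (Node l r) = r"

definition enc_bool :: "bool \<Rightarrow> tree" where
  "enc_bool b = (if b then Node Leaf Leaf else Leaf)"

datatype exp =
    Var nat
  | Const tree
  | Join exp exp
  | Fst exp
  | Snd exp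
  | Eq exp exp

datatype com =
    Skip
  | Assign nat exp
  | Query nat exp
  | Seq com com
  | Cond exp com com
  | While exp com

type_synonym store = "nat \<Rightarrow> tree"
type_synonym oracle_fun = "tree \<Rightarrow> bool"

primrec eval_exp :: "exp \<Rightarrow> store \<Rightarrow> tree" where
  "eval_exp (Var x) s = s x"
| "eval_exp (Const t) s = t"
| "eval_exp (Join e f) s = Node (eval_exp e s) (eval_exp f s)"
| "eval_exp (Fst e) s = left (eval_exp e s)"
| "eval_exp (Snd e) s = right (eval_exp e s)"
| "eval_exp (Eq e f) s = enc_bool (eval_exp e s = eval_exp f s)"

primrec cost :: "exp \<Rightarrow> store \<Rightarrow> nat" where
  "cost (Var x) s = tsize (s x)"
| "cost (Const t) s = tsize t"
| "cost (Join e f) s = cost e s + cost f s + tsize (eval_exp (Join e f) s)"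
| "cost (Fst e) s = cost e s + tsize (eval_exp (Fst e) s)"
| "cost (Snd e) s = cost e s + tsize (eval_exp (Snd e) s)"
| "cost (Eq e f) s = cost e s + cost f s + tsize (eval_exp (Eq e f) s)"

text \<open>\<open>exec Q c s n s'\<close>: with oracle \<open>Q\<close> and from store \<open>s\<close>, the command \<open>c\<close> terminates in
  store \<open>s'\<close> after time \<open>n\<close>. A test succeeds if its value is not \<open>Leaf\<close>.\<close>

inductive exec :: "oracle_fun \<Rightarrow> com \<Rightarrow> store \<Rightarrow> nat \<Rightarrow> store \<Rightarrow> bool" for Q where
  Skip: "exec Q Skip s 1 s"
| Assign: "exec Q (Assign x e) s (1 + cost e s) (s(x := eval_exp e s))"
| Query: "exec Q (Query x e) s (1 + cost e s) (s(x := enc_bool (Q (eval_exp e s))))"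
| Seq: "exec Q c s m s' \<Longrightarrow> exec Q d s' n s'' \<Longrightarrow> exec Q (Seq c d) s (m + n) s''"
| CondTrue: "eval_exp e s \<noteq> Leaf \<Longrightarrow> exec Q c s n s' \<Longrightarrow> exec Q (Cond e c d) s (1 + cost e s + n) s'"
| CondFalse: "eval_exp e s = Leaf \<Longrightarrow> exec Q d s n s' \<Longrightarrow> exec Q (Cond e c d) s (1 + cost e s + n) s'"
| WhileFalse: "eval_exp e s = Leaf \<Longrightarrow> exec Q (While e c) s (1 + cost e s) s"
| WhileTrue: "eval_exp e s \<noteq> Leaf \<Longrightarrow> exec Q c s m s' \<Longrightarrow> exec Q (While e c) s' n s'' \<Longrightarrow>
    exec Q (While e c) s (1 + cost e s + m + n) s''"

inductive_cases SkipE: "exec Q Skip s n t"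
inductive_cases AssignE: "exec Q (Assign x e) s n t"
inductive_cases QueryE: "exec Q (Query x e) s n t"
inductive_cases SeqE: "exec Q (Seq c d) s n t"
inductive_cases CondE: "exec Q (Cond e c d) s n t"
inductive_cases WhileE: "exec Q (While e c) s n t"

lemma exec_deterministic:
  "exec Q c s n t \<Longrightarrow> exec Q c s n' t' \<Longrightarrow> n' = n \<and> t' = t"
proof (induction arbitrary: n' t' rule: exec.induct)
  case Skip then show ?case by - (erule SkipE; auto)
next
  case Assign then show ?case by - (erule AssignE; auto)
next
  case Query then show ?case by - (erule QueryE; auto)
next
  case (Seq c s m s' d n s'')
  from Seq.prems obtain k u k' where
    "exec Q c s k u" "exec Q d u k' t'" "n' = k + k'" by - (erule SeqE; auto)
  with Seq.IH show ?case by metis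
next
  case (CondTrue e s c n s' d)
  from CondTrue.prems CondTrue.hyps obtain k where
    "exec Q c s k t'" "n' = 1 + cost e s + k" by - (erule CondE; auto)
  with CondTrue.IH show ?case by metis
next
  case (CondFalse e s d n s' c)
  from CondFalse.prems CondFalse.hyps obtain k where
    "exec Q d s k t'" "n' = 1 + cost e s + k" by - (erule CondE; auto)
  with CondFalse.IH show ?case by metis
next
  case (WhileFalse e s c)
  from WhileFalse.prems WhileFalse.hyps show ?case by - (erule WhileE; auto)
next
  case (WhileTrue e s c m s' n s'')
  from WhileTrue.prems WhileTrue.hyps(1) obtain k u k' where
    "exec Q c s k u" "exec Q (While e c) u k' t'" "n' = 1 + cost e s + k + k'"
    by - (erule WhileE; auto)
  with WhileTrue.IH show ?case by metis
qed

text \<open>Input and output are held in variable 0; all other variables are initially \<open>Leaf\<close>.\<close>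

definition computes_within :: "oracle_fun \<Rightarrow> com \<Rightarrow> tree \<Rightarrow> tree \<Rightarrow> nat \<Rightarrow> bool" where
  "computes_within Q c x y b \<longleftrightarrow>
     (\<exists>n s. exec Q c ((\<lambda>_. Leaf)(0 := x)) n s \<and> s 0 = y \<and> n \<le> b)"


section \<open>Encodings\<close>

text \<open>Binary representation, least significant bit first.\<close>

fun enc_nat :: "nat \<Rightarrow> tree" where
  "enc_nat n = (if n = 0 then Leaf else Node (enc_bool (odd n)) (enc_nat (n div 2)))"

declare enc_nat.simps [simp del]

definition enc_int :: "int \<Rightarrow> tree" where
  "enc_int k = Node (enc_bool (k < 0)) (enc_nat (nat \<bar>k\<bar>))"

text \<open>Numerator and positive denominator of the reduced fraction.\<close>

definition enc_rat :: "rat \<Rightarrow> tree" where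
  "enc_rat q = (let (a, b) = quotient_of q in Node (enc_int a) (enc_int b))"

primrec enc_list :: "tree list \<Rightarrow> tree" where
  "enc_list [] = Leaf"
| "enc_list (t # ts) = Node t (enc_list ts)"

definition enc_set :: "nat set \<Rightarrow> tree" where
  "enc_set A = enc_list (map enc_nat (sorted_list_of_set A))"

definition enc_map :: "(nat \<Rightarrow> tree) \<Rightarrow> nat set \<Rightarrow> tree" where
  "enc_map f A = enc_list (map (\<lambda>a. Node (enc_nat a) (f a)) (sorted_list_of_set A))"

definition enc_palette :: "rat list \<Rightarrow> tree" where
  "enc_palette p = enc_list (map enc_rat p)"

primrec enc_exp :: "exp \<Rightarrow> tree" where
  "enc_exp (Var x) = Node (enc_nat 0) (enc_nat x)"
| "enc_exp (Const t) = Node (enc_nat 1) t"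
| "enc_exp (Join e f) = Node (enc_nat 2) (Node (enc_exp e) (enc_exp f))"
| "enc_exp (Fst e) = Node (enc_nat 3) (enc_exp e)"
| "enc_exp (Snd e) = Node (enc_nat 4) (enc_exp e)"
| "enc_exp (Eq e f) = Node (enc_nat 5) (Node (enc_exp e) (enc_exp f))"

primrec enc_com :: "com \<Rightarrow> tree" where
  "enc_com Skip = Node (enc_nat 0) Leaf"
| "enc_com (Assign x e) = Node (enc_nat 1) (Node (enc_nat x) (enc_exp e))"
| "enc_com (Query x e) = Node (enc_nat 2) (Node (enc_nat x) (enc_exp e))"
| "enc_com (Seq c d) = Node (enc_nat 3) (Node (enc_com c) (enc_com d))"
| "enc_com (Cond e c d) = Node (enc_nat 4) (Node (enc_exp e) (Node (enc_com c) (enc_com d)))"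
| "enc_com (While e c) = Node (enc_nat 5) (Node (enc_exp e) (enc_com c))"

text \<open>The graph is given by adjacency lists.\<close>

definition enc_setting :: "('x) setting_scheme \<Rightarrow> tree" where
  "enc_setting S = enc_list
     [enc_set (verts S),
      enc_map (\<lambda>v. enc_set (nbrs S v)) (verts S),
      enc_set (refugees S),
      enc_set (inhabitants S),
      enc_map (\<lambda>h. enc_nat (place S h)) (inhabitants S)]"

text \<open>The approval sets of a hedonic instance are not part of the explicit input; they are
  accessible only through this oracle, which takes an agent together with a set.\<close>

definition hedonic_oracle :: "hedonic \<Rightarrow> oracle_fun" where
  "hedonic_oracle H t \<longleftrightarrow>
     (\<exists>a\<in>agents H. \<exists>S\<in>approved_sets H a. t = Node (enc_nat a) (enc_set S))"

text \<open>In an explicitly given diversity instance, the approval set of agent \<open>a\<close> is replaced by the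
  text of a program \<open>proc a\<close>.\<close>

definition enc_diversity :: "diversity \<Rightarrow> (nat \<Rightarrow> com) \<Rightarrow> tree" where
  "enc_diversity J proc = enc_list
     [enc_setting J,
      enc_list (map enc_set (types J)),
      enc_map (\<lambda>r. enc_com (proc r)) (refugees J),
      enc_map (\<lambda>h. enc_com (proc h)) (inhabitants J)]"

lemma enc_bool_inject [simp]: "enc_bool a = enc_bool b \<longleftrightarrow> a = b"
  by (auto simp: enc_bool_def)

lemma enc_nat_0 [simp]: "enc_nat 0 = Leaf"
  by (simp add: enc_nat.simps)

lemma enc_nat_pos: "n > 0 \<Longrightarrow> enc_nat n = Node (enc_bool (odd n)) (enc_nat (n div 2))"
  by (subst enc_nat.simps) simp

lemma enc_nat_inject [simp]: "enc_nat m = enc_nat n \<longleftrightarrow> m = n"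
proof (induction m arbitrary: n rule: less_induct)
  case (less m)
  show ?case
  proof (cases "m = 0 \<or> n = 0")
    case True
    then show ?thesis by (metis enc_nat_0 enc_nat_pos neq0_conv tree.distinct(1))
  next
    case False
    then have pos: "m > 0" "n > 0" by auto
    then have IH: "enc_nat (m div 2) = enc_nat (n div 2) \<longleftrightarrow> m div 2 = n div 2"
      using less by simp
    have "enc_nat m = enc_nat n \<longleftrightarrow> (odd m \<longleftrightarrow> odd n) \<and> m div 2 = n div 2"
      unfolding enc_nat_pos[OF pos(1)] enc_nat_pos[OF pos(2)] tree.inject IH enc_bool_inject ..
    also have "\<dots> \<longleftrightarrow> m = n"
      by presburger
    finally show ?thesis .
  qed
qed

lemma enc_nat_eq_Leaf [simp]: "enc_nat n = Leaf \<longleftrightarrow> n = 0" "Leaf = enc_nat n \<longleftrightarrow> n = 0"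
  using enc_nat_inject[of n 0] enc_nat_inject[of 0 n] by (auto simp del: enc_nat_inject)

lemma enc_list_inject [simp]: "enc_list xs = enc_list ys \<longleftrightarrow> xs = ys"
proof (induction xs arbitrary: ys)
  case Nil then show ?case by (cases ys) auto
next
  case (Cons x xs) then show ?case by (cases ys) auto
qed

lemma enc_exp_inject [simp]: "enc_exp e = enc_exp f \<longleftrightarrow> e = f"
proof (induction e arbitrary: f)
  case (Var x) then show ?case by (cases f) auto
next
  case (Const x) then show ?case by (cases f) auto
next
  case (Join e1 e2) then show ?case by (cases f) auto
next
  case (Fst e) then show ?case by (cases f) auto
next
  case (Snd e) then show ?case by (cases f) auto
next
  case (Eq e1 e2) then show ?case by (cases f) auto
qed

lemma enc_com_inject [simp]: "enc_com c = enc_com d \<longleftrightarrow> c = d"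
proof (induction c arbitrary: d)
  case Skip then show ?case by (cases d) auto
next
  case (Assign x e) then show ?case by (cases d) auto
next
  case (Query x e) then show ?case by (cases d) auto
next
  case (Seq c1 c2) then show ?case by (cases d) auto
next
  case (Cond e c1 c2) then show ?case by (cases d) auto
next
  case (While e c) then show ?case by (cases d) auto
qed


section \<open>Polynomial-time reductions between the two problems\<close>

text \<open>One program \<open>M\<close> and one polynomial \<open>p\<close> serve all instances. On every hedonic instance, \<open>M\<close>
  outputs the diversity instance together with one oracle procedure for each agent. Each
  procedure, again with access to the hedonic oracles only, decides for every palette of a set of
  agents whether the agent approves of it; its running time is polynomial in the sizes of the
  hedonic instance and of the palette.\<close>

definition poly_time_reduction :: "(hedonic \<Rightarrow> diversity) \<Rightarrow> bool" where
  "poly_time_reduction red \<longleftrightarrow> (\<exists>M. \<exists>p :: nat poly. \<forall>H. hedonic_instance H \<longrightarrow>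
     (\<exists>proc.
        computes_within (hedonic_oracle H) M (enc_setting H) (enc_diversity (red H) proc)
          (poly p (tsize (enc_setting H))) \<and>
        (\<forall>a\<in>agents (red H). \<forall>q\<in>palette (types (red H)) ` Pow (agents (red H)).
           computes_within (hedonic_oracle H) (proc a) (enc_palette q)
             (enc_bool (q \<in> approved_palettes (red H) a))
             (poly p (tsize (enc_setting H) + tsize (enc_palette q))))))"

end

theory Submission
  imports Defs
begin

text \<open>Every agent is a type of its own. A palette then determines the set it comes from: the
  numerators of its entries are nonzero exactly at the members. The neighborhood of an inhabitant
  may contain further inhabitants, and that of a refugee further refugees, so an agent approves of
  a palette iff it approves of the part of the set that lies in the other group. An oracle
  procedure recovers that part from the palette and passes it to the hedonic oracle; all procedures
  are the same code up to one constant, which the reduction fills in.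

  Running times are estimated as a number of steps, independent of the store, times a bound on the
  size of all values ever stored.\<close>

section \<open>Running times relative to a bound on the store\<close>

definition bounded :: "nat \<Rightarrow> store \<Rightarrow> bool" where
  "bounded K s \<longleftrightarrow> (\<forall>x. tsize (s x) \<le> K)"

text \<open>The factor by which a value can exceed the bound on the store. A constant counts with
  its full size, so the factor depends on the program text alone.\<close>

primrec exp_weight :: "exp \<Rightarrow> nat" where
  "exp_weight (Var x) = 1"
| "exp_weight (Const t) = tsize t"
| "exp_weight (Join e f) = 1 + exp_weight e + exp_weight f"
| "exp_weight (Fst e) = 1 + exp_weight e"
| "exp_weight (Snd e) = 1 + exp_weight e"
| "exp_weight (Eq e f) = 1 + exp_weight e + exp_weight f"

lemma tsize_pos: "1 \<le> tsize t"
  by (cases t) auto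

lemma exp_weight_pos: "1 \<le> exp_weight e"
  by (induction e) (use tsize_pos in auto)

lemma bounded_pos: "bounded K s \<Longrightarrow> 1 \<le> K"
  unfolding bounded_def using tsize_pos le_trans by blast

lemma tsize_left: "tsize (left t) \<le> tsize t"
  by (cases t) auto

lemma tsize_right: "tsize (right t) \<le> tsize t"
  by (cases t) auto

lemma tsize_eval_le:
  assumes "bounded K s"
  shows "tsize (eval_exp e s) \<le> exp_weight e * K"
proof (induction e)
  case (Var x) then show ?case using assms by (simp add: bounded_def)
next
  case (Const t) then show ?case using bounded_pos[OF assms] by simp
next
  case (Join e f) then show ?case using bounded_pos[OF assms] by (simp add: algebra_simps)
next
  case (Fst e) then show ?case using tsize_left[of "eval_exp e s"] by simp
next
  case (Snd e) then show ?case using tsize_right[of "eval_exp e s"] by simp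
next
  case (Eq e f)
  \<comment> \<open>The encoding of \<open>True\<close> has size 3, which is covered because both
    operands weigh at least 1.\<close>
  have "3 \<le> exp_weight (Eq e f)" using exp_weight_pos[of e] exp_weight_pos[of f] by simp
  then have "3 * 1 \<le> exp_weight (Eq e f) * K" using bounded_pos[OF assms] by (rule mult_le_mono)
  then show ?case by (simp add: enc_bool_def)
qed

text \<open>The square arises because evaluation is charged for all intermediate values: there are
  at most \<open>exp_weight e\<close> of them, each of size at most
  \<open>exp_weight e * K\<close>.\<close>

lemma cost_le:
  assumes "bounded K s"
  shows "cost e s \<le> (exp_weight e)\<^sup>2 * K"
proof (induction e)
  case (Var x) then show ?case using assms by (simp add: bounded_def)
next
  case (Const t)
  have "tsize t * 1 \<le> (tsize t * tsize t) * K"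
    using bounded_pos[OF assms] tsize_pos[of t] by (intro mult_le_mono) auto
  then show ?case by (simp add: power2_eq_square)
next
  case (Join e f)
  then show ?case using tsize_eval_le[OF assms, of "Join e f"]
    by (simp add: power2_eq_square algebra_simps)
next
  case (Fst e)
  then show ?case using tsize_eval_le[OF assms, of e] tsize_left[of "eval_exp e s"]
    by (simp add: power2_eq_square algebra_simps)
next
  case (Snd e)
  then show ?case using tsize_eval_le[OF assms, of e] tsize_right[of "eval_exp e s"]
    by (simp add: power2_eq_square algebra_simps)
next
  case (Eq e f)
  then show ?case using tsize_eval_le[OF assms, of "Eq e f"]
    by (simp add: power2_eq_square algebra_simps)
qed

text \<open>Separates the number \<open>b\<close> of steps from the size bound \<open>K\<close>.
  That the stores obey \<open>K\<close> is not part of the relation; each rule asks for what it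
  needs.\<close>

definition runs :: "oracle_fun \<Rightarrow> nat \<Rightarrow> com \<Rightarrow> store \<Rightarrow> nat \<Rightarrow> store \<Rightarrow> bool" where
  "runs Q K c s b s' \<longleftrightarrow> (\<exists>n. exec Q c s n s' \<and> n \<le> b * K)"

definition step_weight :: "exp \<Rightarrow> nat" where
  "step_weight e = 1 + (exp_weight e)\<^sup>2"

lemma step_cost_le:
  assumes "bounded K s"
  shows "1 + cost e s \<le> step_weight e * K"
  using cost_le[OF assms, of e] bounded_pos[OF assms]
  by (simp add: step_weight_def algebra_simps)

lemma runs_mono: "runs Q K c s b s' \<Longrightarrow> b \<le> b' \<Longrightarrow> runs Q K c s b' s'"
  unfolding runs_def by (meson le_trans mult_le_mono1)

lemma runs_Skip: "bounded K s \<Longrightarrow> runs Q K Skip s 1 s"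
  unfolding runs_def using exec.Skip bounded_pos by fastforce

lemma runs_Assign:
  "bounded K s \<Longrightarrow> s' = s(x := eval_exp e s) \<Longrightarrow> runs Q K (Assign x e) s (step_weight e) s'"
  unfolding runs_def using exec.Assign step_cost_le by blast

text \<open>The constant in \<open>ask\<close> depends on the instance. Charging it to
  \<open>K\<close> keeps the number of steps free of its size, whereas
  \<open>step_weight (Const t)\<close> would be quadratic in it.\<close>

lemma runs_Assign_Const:
  assumes "tsize t \<le> K" "s' = s(x := t)"
  shows "runs Q K (Assign x (Const t)) s 2 s'"
proof -
  have "exec Q (Assign x (Const t)) s (1 + tsize t) s'"
    using exec.Assign[of Q x "Const t" s] assms(2) by simp
  moreover have "1 + tsize t \<le> 2 * K" using assms(1) tsize_pos[of t] by simp
  ultimately show ?thesis unfolding runs_def by blast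
qed

lemma runs_Query:
  "bounded K s \<Longrightarrow> s' = s(x := enc_bool (Q (eval_exp e s))) \<Longrightarrow>
    runs Q K (Query x e) s (step_weight e) s'"
  unfolding runs_def using exec.Query step_cost_le by blast

lemma runs_Seq:
  "runs Q K c s b s' \<Longrightarrow> runs Q K d s' b' s'' \<Longrightarrow> runs Q K (Seq c d) s (b + b') s''"
  unfolding runs_def by (metis exec.Seq add_mono add_mult_distrib)

lemma runs_Cond:
  assumes "bounded K s"
    and "eval_exp e s \<noteq> Leaf \<Longrightarrow> runs Q K c s b s'"
    and "eval_exp e s = Leaf \<Longrightarrow> runs Q K d s b s'"
  shows "runs Q K (Cond e c d) s (step_weight e + b) s'"
proof -
  have "\<exists>n. exec Q (Cond e c d) s (1 + cost e s + n) s' \<and> n \<le> b * K"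
    using assms(2,3) unfolding runs_def by (meson exec.CondTrue exec.CondFalse)
  then show ?thesis
    using step_cost_le[OF assms(1), of e] unfolding runs_def
    by (metis add_mono add_mult_distrib)
qed

text \<open>The loop is described by the explicit sequence \<open>st\<close> of stores at the test.
  The factor \<open>Suc k\<close> accounts for the final, failing test.\<close>

lemma runs_While:
  assumes "\<And>i. i < k \<Longrightarrow> eval_exp e (st i) \<noteq> Leaf" "eval_exp e (st k) = Leaf"
    and "\<And>i. i \<le> k \<Longrightarrow> bounded K (st i)"
    and "\<And>i. i < k \<Longrightarrow> runs Q K c (st i) b (st (Suc i))"
  shows "runs Q K (While e c) (st 0) (Suc k * (step_weight e + b)) (st k)"
  using assms
proof (induction k arbitrary: st)
  case 0
  have "exec Q (While e c) (st 0) (1 + cost e (st 0)) (st 0)"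
    using 0 by (intro exec.WhileFalse) auto
  moreover have "1 + cost e (st 0) \<le> (Suc 0 * (step_weight e + b)) * K"
    using step_cost_le[of K "st 0" e] 0(3) by (simp add: algebra_simps)
  ultimately show ?case unfolding runs_def by blast
next
  case (Suc k)
  have "runs Q K (While e c) (st (Suc 0)) (Suc k * (step_weight e + b)) (st (Suc k))"
    by (rule Suc.IH[of "\<lambda>i. st (Suc i)"]) (use Suc.prems in auto)
  then obtain n where n: "exec Q (While e c) (st (Suc 0)) n (st (Suc k))"
      "n \<le> (Suc k * (step_weight e + b)) * K"
    unfolding runs_def by blast
  obtain m where m: "exec Q c (st 0) m (st (Suc 0))" "m \<le> b * K"
    using Suc.prems(4)[of 0] unfolding runs_def by blast
  have "exec Q (While e c) (st 0) (1 + cost e (st 0) + m + n) (st (Suc k))"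
    using Suc.prems(1)[of 0] m n by (intro exec.WhileTrue) auto
  moreover have "1 + cost e (st 0) + m + n \<le> (Suc (Suc k) * (step_weight e + b)) * K"
    using step_cost_le[of K "st 0" e] Suc.prems(3)[of 0] m(2) n(2) by (simp add: algebra_simps)
  ultimately show ?case unfolding runs_def by blast
qed

section \<open>Programs on lists\<close>

lemma tsize_enc_list: "tsize (enc_list ts) = 1 + (\<Sum>t\<leftarrow>ts. 1 + tsize t)"
  by (induction ts) auto

lemma tsize_enc_list_append_le:
  "tsize (enc_list xs) \<le> tsize (enc_list (xs @ ys))"
  "tsize (enc_list ys) \<le> tsize (enc_list (xs @ ys))"
  by (auto simp: tsize_enc_list)

lemma tsize_enc_list_rev [simp]: "tsize (enc_list (rev ts)) = tsize (enc_list ts)"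
  by (simp add: tsize_enc_list flip: rev_map)

lemma tsize_enc_list_drop_le: "tsize (enc_list (drop i ts)) \<le> tsize (enc_list ts)"
  using tsize_enc_list_append_le(2)[of "drop i ts" "take i ts"] by simp

lemma tsize_enc_list_take_le: "tsize (enc_list (take i ts)) \<le> tsize (enc_list ts)"
  using tsize_enc_list_append_le(1)[of "take i ts" "drop i ts"] by simp

lemma tsize_enc_list_filter_le:
  "tsize (enc_list (map f (filter P xs))) \<le> tsize (enc_list (map f xs))"
  by (induction xs) auto

lemma tsize_enc_list_bound:
  "(\<And>t. t \<in> set ts \<Longrightarrow> tsize t \<le> B) \<Longrightarrow> tsize (enc_list ts) \<le> 1 + length ts * (1 + B)"
  by (induction ts) force+

lemma length_le_tsize: "length ts \<le> tsize (enc_list ts)"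
  by (induction ts) auto

lemma tsize_nth_le: "t \<in> set ts \<Longrightarrow> tsize t \<le> tsize (enc_list ts)"
  by (induction ts) auto

lemma right_enc_list [simp]: "right (enc_list ts) = enc_list (tl ts)"
  by (cases ts) auto

lemma left_enc_list_drop: "i < length ts \<Longrightarrow> left (enc_list (drop i ts)) = ts ! i"
  by (metis Cons_nth_drop_Suc enc_list.simps(2) left.simps(2))

lemma enc_list_drop_Leaf_iff: "enc_list (drop i ts) = Leaf \<longleftrightarrow> length ts \<le> i"
  by (metis drop_eq_Nil enc_list.simps(1) enc_list_inject)

text \<open>All list processing of \<open>reducer\<close> is an instance: reversal, mapping and
  concatenation differ only in \<open>src\<close>, \<open>y\<close> and \<open>e\<close>. The
  expression \<open>e\<close> finds the current element at the head of variable 1.\<close>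

definition push_loop :: "exp \<Rightarrow> nat \<Rightarrow> exp \<Rightarrow> com" where
  "push_loop src y e =
     Seq (Assign 1 src)
         (While (Var 1) (Seq (Assign y (Join e (Var y))) (Assign 1 (Snd (Var 1)))))"

definition push_weight :: "exp \<Rightarrow> nat \<Rightarrow> exp \<Rightarrow> nat" where
  "push_weight src y e = step_weight src + 
     (step_weight (Var 1) + (step_weight (Join e (Var y)) + step_weight (Snd (Var 1))))"

text \<open>On the output side only the final list needs a size bound: elements are pushed in front,
  so every intermediate accumulator is a suffix of it.\<close>

lemma runs_push_loop:
  assumes K: "bounded K s" and y: "y \<noteq> 1"
    and src: "eval_exp src s = enc_list ts" and us: "s y = enc_list us"
    and e: "\<And>t r v. t \<in> set ts \<Longrightarrow> eval_exp e (s(1 := Node t r, y := v)) = f t"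
    and ts: "tsize (enc_list ts) \<le> K"
    and out: "tsize (enc_list (map f (rev ts) @ us)) \<le> K"
    and s': "s' = s(1 := Leaf, y := enc_list (map f (rev ts) @ us))"
  shows "runs Q K (push_loop src y e) s (Suc (length ts) * push_weight src y e) s'"
proof -
  define acc where "acc i = enc_list (map f (rev (take i ts)) @ us)" for i
  define st where "st i = s(1 := enc_list (drop i ts), y := acc i)" for i
  have acc_le: "tsize (acc i) \<le> K" for i
  proof -
    have "map f (rev ts) @ us = map f (rev (drop i ts)) @ map f (rev (take i ts)) @ us"
      by (metis append.assoc append_take_drop_id map_append rev_append)
    then show ?thesis
      unfolding acc_def using out tsize_enc_list_append_le(2) le_trans by metis
  qed
  have drop_le: "tsize (enc_list (drop i ts)) \<le> K" for i
    using tsize_enc_list_drop_le ts le_trans by blast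
  have st_le: "bounded K (st i)" for i
    using K acc_le drop_le by (auto simp: st_def bounded_def)
  let ?body = "Seq (Assign y (Join e (Var y))) (Assign 1 (Snd (Var 1)))"
  let ?b = "step_weight (Join e (Var y)) + step_weight (Snd (Var 1))"
  have body: "runs Q K ?body (st i) ?b (st (Suc i))" if i: "i < length ts" for i
  proof (rule runs_Seq[where s' = "s(1 := enc_list (drop i ts), y := acc (Suc i))"])
    have "eval_exp e (st i) = f (ts ! i)"
      using e[of "ts ! i"] i by (metis st_def nth_mem Cons_nth_drop_Suc enc_list.simps(2))
    moreover have "acc (Suc i) = Node (f (ts ! i)) (acc i)"
      using i by (simp add: acc_def take_Suc_conv_app_nth)
    moreover have "st i y = acc i" by (simp add: st_def)
    ultimately show "runs Q K (Assign y (Join e (Var y))) (st i) (step_weight (Join e (Var y)))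
        (s(1 := enc_list (drop i ts), y := acc (Suc i)))"
      by (intro runs_Assign[OF st_le]) (auto simp: st_def)
    show "runs Q K (Assign 1 (Snd (Var 1))) (s(1 := enc_list (drop i ts), y := acc (Suc i)))
        (step_weight (Snd (Var 1))) (st (Suc i))"
    proof (rule runs_Assign)
      show "bounded K (s(1 := enc_list (drop i ts), y := acc (Suc i)))"
        using K acc_le drop_le by (auto simp: bounded_def)
    qed (use y in \<open>auto simp: st_def fun_eq_iff drop_Suc tl_drop\<close>)
  qed
  have loop: "runs Q K (While (Var 1) ?body) (st 0)
      (Suc (length ts) * (step_weight (Var 1) + ?b)) (st (length ts))"
  proof (rule runs_While)
    show "eval_exp (Var 1) (st i) \<noteq> Leaf" if "i < length ts" for i
      using that y by (simp add: st_def enc_list_drop_Leaf_iff)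
    show "eval_exp (Var 1) (st (length ts)) = Leaf" using y by (simp add: st_def)
  qed (use body st_le in auto)
  have start: "runs Q K (Assign 1 src) s (step_weight src) (st 0)"
    by (rule runs_Assign[OF K]) (use us y src in \<open>auto simp: st_def acc_def\<close>)
  have "st (length ts) = s'" by (simp add: st_def acc_def s')
  then have "runs Q K (push_loop src y e) s
      (step_weight src + Suc (length ts) * (step_weight (Var 1) + ?b)) s'"
    using runs_Seq[OF start loop] by (simp add: push_loop_def)
  then show ?thesis
    by (rule runs_mono) (simp add: push_weight_def algebra_simps)
qed

section \<open>Stores given by finite lists\<close>

definition mem :: "tree list \<Rightarrow> store" where
  "mem ts x = (if x < length ts then ts ! x else Leaf)"

text \<open>Together with \<open>mem_apply\<close> and \<open>bounded_mem\<close> this lets the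
  simplifier run straight-line code on concrete stores. Variables beyond the list hold
  \<open>Leaf\<close>, as they do initially.\<close>

lemma mem_upd: "x < length ts \<Longrightarrow> (mem ts)(x := v) = mem (ts[x := v])"
  by (auto simp: mem_def fun_eq_iff)

lemma mem_apply: "x < length ts \<Longrightarrow> mem ts x = ts ! x"
  by (simp add: mem_def)

lemma mem_init: "(\<lambda>_. Leaf)(0 := t) = mem (t # replicate n Leaf)"
  by (auto simp: mem_def fun_eq_iff nth_Cons split: nat.split)

lemma bounded_mem: "1 \<le> K \<Longrightarrow> bounded K (mem ts) \<longleftrightarrow> (\<forall>t\<in>set ts. tsize t \<le> K)"
  unfolding bounded_def mem_def all_set_conv_all_nth by simp

section \<open>The oracle procedures\<close>

text \<open>Variable 1 holds the agent, a list whose length is the number of palette entries to skip,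
  and the names of the agents that own the entries that follow. The numerator of an entry is
  nonzero iff its owner belongs to the set.\<close>

definition skip_body :: com where
  "skip_body = Seq (Assign 0 (Snd (Var 0))) (Assign 2 (Snd (Var 2)))"

text \<open>In the test, the path from variable 0 leads to the first palette entry, then to its
  numerator, and past the sign to the absolute value.\<close>

definition collect_body :: com where
  "collect_body = Seq
     (Cond (Snd (Fst (Fst (Var 0)))) (Assign 3 (Join (Fst (Var 2)) (Var 3))) Skip)
     skip_body"

definition ask_code :: com where
  "ask_code =
     Seq (Assign 2 (Fst (Snd (Var 1))))
    (Seq (While (Var 2) skip_body)
    (Seq (Assign 2 (Snd (Snd (Var 1))))
    (Seq (While (Var 2) collect_body)
         (Query 0 (Join (Fst (Var 1)) (Var 3))))))"

definition ask :: "tree \<Rightarrow> com" where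
  "ask t = Seq (Assign 1 (Const t)) ask_code"

definition skip_weight :: nat where
  "skip_weight = step_weight (Snd (Var 0)) + step_weight (Snd (Var 2))"

definition collect_weight :: nat where
  "collect_weight = step_weight (Snd (Fst (Fst (Var 0)))) +
     (step_weight (Join (Fst (Var 2)) (Var 3)) + 1) + skip_weight"

definition ask_weight :: nat where
  "ask_weight = 2 + step_weight (Fst (Snd (Var 1))) + (step_weight (Var 2) + skip_weight) +
     step_weight (Snd (Snd (Var 1))) + (step_weight (Var 2) + collect_weight) +
     step_weight (Join (Fst (Var 1)) (Var 3))"

lemma runs_skip_body:
  assumes "1 \<le> K" "tsize (enc_list ps) \<le> K" "tsize c \<le> K" "tsize (enc_list us) \<le> K" "tsize v \<le> K"
  shows "runs Q K skip_body (mem [enc_list ps, c, enc_list us, v]) skip_weight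
    (mem [enc_list (tl ps), c, enc_list (tl us), v])"
  unfolding skip_body_def skip_weight_def
proof (rule runs_Seq)
  have le: "tsize (enc_list (tl ps)) \<le> K"
    using assms(2) tsize_enc_list_drop_le[of 1 ps] by (simp add: drop_Suc)
  show "runs Q K (Assign 0 (Snd (Var 0))) (mem [enc_list ps, c, enc_list us, v])
      (step_weight (Snd (Var 0))) (mem [enc_list (tl ps), c, enc_list us, v])"
    by (rule runs_Assign) (use assms in \<open>auto simp: bounded_mem mem_upd mem_apply\<close>)
  show "runs Q K (Assign 2 (Snd (Var 2))) (mem [enc_list (tl ps), c, enc_list us, v])
      (step_weight (Snd (Var 2))) (mem [enc_list (tl ps), c, enc_list (tl us), v])"
    by (rule runs_Assign) (use assms le in \<open>auto simp: bounded_mem mem_upd mem_apply\<close>)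
qed

lemma runs_collect_body:
  assumes "1 \<le> K" "tsize (enc_list ps) \<le> K" "tsize c \<le> K" "tsize (enc_list us) \<le> K" "tsize v \<le> K"
    and v': "tsize v' \<le> K"
      "v' = (if right (left (left (enc_list ps))) = Leaf then v else Node (left (enc_list us)) v)"
  shows "runs Q K collect_body (mem [enc_list ps, c, enc_list us, v]) collect_weight
    (mem [enc_list (tl ps), c, enc_list (tl us), v'])"
  unfolding collect_body_def collect_weight_def
proof (rule runs_Seq[OF runs_Cond])
  let ?s = "mem [enc_list ps, c, enc_list us, v]"
  let ?s' = "mem [enc_list ps, c, enc_list us, v']"
  show K: "bounded K ?s" using assms by (simp add: bounded_mem)
  show "runs Q K (Assign 3 (Join (Fst (Var 2)) (Var 3))) ?s
      (step_weight (Join (Fst (Var 2)) (Var 3)) + 1) ?s'"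
    if "eval_exp (Snd (Fst (Fst (Var 0)))) ?s \<noteq> Leaf"
    by (rule runs_mono[OF runs_Assign[OF K]]) (use that v' in \<open>auto simp: mem_upd mem_apply\<close>)
  show "runs Q K Skip ?s (step_weight (Join (Fst (Var 2)) (Var 3)) + 1) ?s'"
    if "eval_exp (Snd (Fst (Fst (Var 0)))) ?s = Leaf"
  proof -
    have "?s' = ?s" using that v' by (simp add: mem_apply)
    then show ?thesis using runs_mono[OF runs_Skip[OF K]] by simp
  qed
  show "runs Q K skip_body ?s' skip_weight (mem [enc_list (tl ps), c, enc_list (tl us), v'])"
    by (rule runs_skip_body) (use assms in auto)
qed

text \<open>Only the length of \<open>us\<close> matters: it counts the entries to pass over. The
  next entries belong to the members of \<open>l\<close>, and later ones are never read. The query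
  contains \<open>rev l\<close> because collected names are pushed in front. Apart from the palette,
  all lists kept are parts of \<open>c\<close> or no larger than such a part, so bounds on
  \<open>ps\<close> and \<open>c\<close> suffice.\<close>

lemma runs_ask:
  fixes l :: "nat list" and S :: "nat set"
  assumes ps: "length us + length l \<le> length ps"
    and mem_S: "\<And>i. i < length l \<Longrightarrow>
      right (left (ps ! (length us + i))) \<noteq> Leaf \<longleftrightarrow> l ! i \<in> S"
    and c: "c = Node a (Node (enc_list us) (enc_list (map enc_nat l)))"
    and K: "tsize (enc_list ps) \<le> K" "tsize c \<le> K"
  shows "\<exists>s. runs Q K (ask c) ((\<lambda>_. Leaf)(0 := enc_list ps))
      ((length us + length l + 1) * ask_weight) s \<and>
    s 0 = enc_bool (Q (Node a (enc_list (map enc_nat (filter (\<lambda>x. x \<in> S) (rev l))))))"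
proof -
  let ?L = "map enc_nat l"
  define acc where "acc i = enc_list (map enc_nat (filter (\<lambda>x. x \<in> S) (rev (take i l))))" for i
  define m where "m = length us"
  have K1: "1 \<le> K" using K(2) tsize_pos le_trans by blast
  have us_le: "tsize (enc_list us) \<le> K" and L_le: "tsize (enc_list ?L) \<le> K"
    using K(2) by (auto simp: c)
  have drop_le: "tsize (enc_list (drop i us)) \<le> K" "tsize (enc_list (drop i ?L)) \<le> K"
    "tsize (enc_list (drop i ps)) \<le> K" for i
    using tsize_enc_list_drop_le us_le L_le K(1) le_trans by blast+
  have acc_le: "tsize (acc i) \<le> K" for i
  proof -
    have "tsize (acc i) \<le> tsize (enc_list (map enc_nat (rev (take i l))))"
      unfolding acc_def by (rule tsize_enc_list_filter_le)
    also have "\<dots> = tsize (enc_list (take i ?L))"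
      by (metis rev_map take_map tsize_enc_list_rev)
    also have "\<dots> \<le> K" using tsize_enc_list_take_le L_le le_trans by blast
    finally show ?thesis .
  qed
  have acc_Suc: "acc (Suc i) = (if l ! i \<in> S then Node (enc_nat (l ! i)) (acc i) else acc i)"
    if "i < length l" for i
    using that by (simp add: acc_def take_Suc_conv_app_nth)
  define st1 where "st1 i = mem [enc_list (drop i ps), c, enc_list (drop i us), Leaf]" for i
  define st2 where "st2 i = mem [enc_list (drop i (drop m ps)), c, enc_list (drop i ?L), acc i]" for i
  have b1: "bounded K (st1 i)" and b2: "bounded K (st2 i)" for i
    using K1 K drop_le acc_le by (auto simp: st1_def st2_def bounded_mem)
  have init: "runs Q K (Assign 1 (Const c)) ((\<lambda>_. Leaf)(0 := enc_list ps)) 2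
      (mem [enc_list ps, c, Leaf, Leaf])"
  proof (rule runs_Assign_Const[OF K(2)])
    show "mem [enc_list ps, c, Leaf, Leaf] = (\<lambda>_. Leaf)(0 := enc_list ps, 1 := c)"
      unfolding mem_init[of _ 3] by (simp add: mem_upd numeral_3_eq_3)
  qed
  have load1: "runs Q K (Assign 2 (Fst (Snd (Var 1)))) (mem [enc_list ps, c, Leaf, Leaf])
      (step_weight (Fst (Snd (Var 1)))) (st1 0)"
    by (rule runs_Assign) (use K K1 in \<open>auto simp: st1_def bounded_mem mem_upd mem_apply c\<close>)
  have body1: "runs Q K skip_body (st1 i) skip_weight (st1 (Suc i))" for i
    using runs_skip_body[OF K1 drop_le(3) K(2) drop_le(1), of Leaf] K1
    by (simp add: st1_def drop_Suc tl_drop)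
  have loop1: "runs Q K (While (Var 2) skip_body) (st1 0)
      (Suc m * (step_weight (Var 2) + skip_weight)) (st1 m)"
    by (rule runs_While) (use b1 body1 in \<open>auto simp: st1_def mem_apply enc_list_drop_Leaf_iff m_def\<close>)
  have load2: "runs Q K (Assign 2 (Snd (Snd (Var 1)))) (st1 m)
      (step_weight (Snd (Snd (Var 1)))) (st2 0)"
    by (rule runs_Assign[OF b1]) (auto simp: st1_def st2_def mem_upd mem_apply c acc_def)
  have body2: "runs Q K collect_body (st2 i) collect_weight (st2 (Suc i))" if i: "i < length l" for i
  proof -
    have "left (enc_list (drop i (drop m ps))) = ps ! (m + i)"
      using left_enc_list_drop[of i "drop m ps"] i ps by (simp add: m_def add.commute)
    moreover have "left (enc_list (drop i ?L)) = enc_nat (l ! i)"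
      using left_enc_list_drop[of i ?L] i by simp
    ultimately have "acc (Suc i) =
        (if right (left (left (enc_list (drop i (drop m ps))))) = Leaf then acc i
         else Node (left (enc_list (drop i ?L))) (acc i))"
      using mem_S[OF i] acc_Suc[OF i] by (auto simp: m_def)
    moreover have "tsize (enc_list (drop i (drop m ps))) \<le> K" using drop_le(3) by simp
    ultimately have "runs Q K collect_body (st2 i) collect_weight
        (mem [enc_list (tl (drop i (drop m ps))), c, enc_list (tl (drop i ?L)), acc (Suc i)])"
      unfolding st2_def by (intro runs_collect_body K1 K(2) drop_le acc_le)
    then show ?thesis by (simp add: st2_def drop_Suc tl_drop)
  qed
  have loop2: "runs Q K (While (Var 2) collect_body) (st2 0)
      (Suc (length l) * (step_weight (Var 2) + collect_weight)) (st2 (length l))"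
    by (rule runs_While) (use b2 body2 in \<open>auto simp: st2_def mem_apply enc_list_drop_Leaf_iff\<close>)
  let ?out = "(st2 (length l))(0 := enc_bool (Q (Node a (acc (length l)))))"
  have query: "runs Q K (Query 0 (Join (Fst (Var 1)) (Var 3))) (st2 (length l))
      (step_weight (Join (Fst (Var 1)) (Var 3))) ?out"
    by (rule runs_Query[OF b2]) (simp add: st2_def mem_apply c)
  \<comment> \<open>Each of the two loops makes at most \<open>length us + length l + 1\<close>
    tests, so this factor can be taken out of the whole sum.\<close>
  have "runs Q K (ask c) ((\<lambda>_. Leaf)(0 := enc_list ps))
      ((length us + length l + 1) * ask_weight) ?out"
    unfolding ask_def ask_code_def
    by (rule runs_mono[OF runs_Seq[OF init runs_Seq[OF load1 runs_Seq[OF loop1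
          runs_Seq[OF load2 runs_Seq[OF loop2 query]]]]]])
      (simp add: ask_weight_def m_def algebra_simps)
  then show ?thesis by (intro exI[of _ ?out]) (simp add: acc_def)
qed

section \<open>The reduction\<close>

text \<open>The agents are listed in decreasing order within each group because a loop that pushes onto
  a list reverses it: the oracle procedures then produce increasing lists.\<close>

definition type_order :: "hedonic \<Rightarrow> nat list" where
  "type_order H =
     rev (sorted_list_of_set (inhabitants H)) @ rev (sorted_list_of_set (refugees H))"

text \<open>The group that the hedonic preferences of \<open>a\<close> are about; an agent that is
  no inhabitant is a refugee.\<close>

definition partners :: "hedonic \<Rightarrow> nat \<Rightarrow> nat set" where
  "partners H a = (if a \<in> inhabitants H then refugees H else inhabitants H)"

text \<open>Describing approved palettes through sets that induce them ensures by construction that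
  they are palettes of sets of agents. The choice of the set is harmless because the palette
  determines it.\<close>

definition red :: "hedonic \<Rightarrow> diversity" where
  "red H = \<lparr>verts = verts H, edges = edges H, refugees = refugees H, inhabitants = inhabitants H,
     place = place H,
     types = map (\<lambda>a. {a}) (type_order H),
     approved_palettes = (\<lambda>a. {palette (map (\<lambda>a. {a}) (type_order H)) S | S.
       S \<subseteq> agents H \<and> S \<inter> partners H a \<in> approved_sets H a})\<rparr>"

lemma red_simps [simp]:
  "refugees (red H) = refugees H" "inhabitants (red H) = inhabitants H" "place (red H) = place H"
  "agents (red H) = agents H" "nbrs (red H) = nbrs H" "housing (red H) = housing H"
  "wf_setting (red H) = wf_setting H" "setting.truncate (red H) = setting.truncate H"
  "types (red H) = map (\<lambda>a. {a}) (type_order H)" "enc_setting (red H) = enc_setting H"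
  by (auto simp: red_def agents_def nbrs_def housing_def free_verts_def wf_setting_def
      setting.truncate_def enc_setting_def enc_map_def fun_eq_iff)

lemma type_order_set:
  assumes "wf_setting H"
  shows "set (type_order H) = agents H" "distinct (type_order H)" "finite (agents H)"
    "length (type_order H) = card (refugees H) + card (inhabitants H)"
  using assms by (auto simp: wf_setting_def type_order_def agents_def)

section \<open>Palettes over singleton types\<close>

lemma nth_palette_eq_0_iff:
  assumes "finite S" "i < length as"
  shows "palette (map (\<lambda>a. {a}) as) S ! i = 0 \<longleftrightarrow> as ! i \<notin> S"
  using assms by (auto simp: palette_def)

text \<open>Every entry is 0 or the reciprocal of the cardinality, so the nonzero positions recover
  the set. The zero tuple of the empty set fits this pattern.\<close>

lemma palette_singletons_inject:
  assumes "finite S" "finite S'" "S \<subseteq> set as" "S' \<subseteq> set as"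
    and "palette (map (\<lambda>a. {a}) as) S = palette (map (\<lambda>a. {a}) as) S'"
  shows "S = S'"
proof -
  have "a \<in> S \<longleftrightarrow> a \<in> S'" if "a \<in> set as" for a
    using that nth_palette_eq_0_iff assms by (metis in_set_conv_nth)
  then show ?thesis using assms by blast
qed

text \<open>By injectivity, the set that witnesses approval in \<open>red\<close> can only be
  \<open>S\<close> itself.\<close>

lemma approved_palettes_red:
  assumes "wf_setting H" "S \<subseteq> agents H"
  shows "palette (types (red H)) S \<in> approved_palettes (red H) a \<longleftrightarrow>
    S \<inter> partners H a \<in> approved_sets H a"
proof -
  have "S' = S" if "S' \<subseteq> agents H"
    "palette (map (\<lambda>a. {a}) (type_order H)) S = palette (map (\<lambda>a. {a}) (type_order H)) S'" for S'
    using palette_singletons_inject[of S' S "type_order H"] type_order_set[OF assms(1)] assms(2) that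
    by (metis finite_subset)
  then show ?thesis using assms(2) by (auto simp: red_def)
qed

section \<open>Validity of the new instance and equivalence\<close>

lemma diversity_instance_red:
  assumes "wf_setting H"
  shows "diversity_instance (red H)"
proof -
  have "partition_on (agents H) ((\<lambda>a. {a}) ` agents H)"
    by (auto simp: partition_on_def disjoint_def)
  then show ?thesis
    using type_order_set[OF assms] assms
    by (auto simp: diversity_instance_def distinct_map red_def[of H] intro: inj_onI
        simp del: red_simps(9)) (simp_all add: red_def agents_def wf_setting_def inj_on_def)
qed

lemma neighborhood_red: "neighborhood (red H) = neighborhood H"
  by (simp add: neighborhood_def position_def fun_eq_iff)

text \<open>The same housings succeed on both sides: cutting a neighborhood down to the partners
  leaves the very set that the hedonic problem judges.\<close>

lemma hedonic_yes_iff_diversity_yes: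
  assumes "wf_setting H"
  shows "hedonic_yes H \<longleftrightarrow> diversity_yes (red H)"
proof -
  have disj: "refugees H \<inter> inhabitants H = {}" using assms by (simp add: wf_setting_def)
  have sub: "neighborhood H \<pi> a \<subseteq> agents H" for \<pi> a by (auto simp: neighborhood_def)
  \<comment> \<open>Disjointness enters through \<open>position\<close>, which gives priority to
    \<open>place\<close>: a refugee sits at \<open>\<pi> r\<close> because it is no
    inhabitant.\<close>
  have h: "neighborhood H \<pi> a \<inter> partners H a = {r \<in> refugees H. \<pi> r \<in> nbrs H (place H a)}"
    if "a \<in> inhabitants H" for \<pi> a
    using that disj by (auto simp: neighborhood_def position_def partners_def agents_def)
  have r: "neighborhood H \<pi> a \<inter> partners H a = {h \<in> inhabitants H. place H h \<in> nbrs H (\<pi> a)}"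
    if "a \<in> refugees H" for \<pi> a
    using that disj by (auto simp: neighborhood_def position_def partners_def agents_def)
  have "diversity_respecting (red H) \<pi> \<longleftrightarrow>
      (\<forall>h\<in>inhabitants H. {r \<in> refugees H. \<pi> r \<in> nbrs H (place H h)} \<in> approved_sets H h) \<and>
      (\<forall>r\<in>refugees H. {h \<in> inhabitants H. place H h \<in> nbrs H (\<pi> r)} \<in> approved_sets H r)" for \<pi>
    unfolding diversity_respecting_def neighborhood_red approved_palettes_red[OF assms sub]
    by (simp add: agents_def ball_Un h r conj_commute)
  then show ?thesis by (simp add: hedonic_yes_def diversity_yes_def)
qed

section \<open>Polynomial running time\<close>

text \<open>Matches the decreasing order within the blocks of \<open>type_order\<close>; the
  collecting loop restores the increasing order of \<open>enc_set\<close>.\<close>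

definition enc_rev :: "nat set \<Rightarrow> tree" where
  "enc_rev A = enc_list (rev (map enc_nat (sorted_list_of_set A)))"

text \<open>Inhabitants come first in \<open>type_order\<close>. The procedure of an inhabitant must
  pass over them to reach the refugees, while that of a refugee starts reading at once.\<close>

definition skipped :: "hedonic \<Rightarrow> nat \<Rightarrow> nat set" where
  "skipped H a = (if a \<in> inhabitants H then inhabitants H else {})"

definition asker :: "hedonic \<Rightarrow> nat \<Rightarrow> com" where
  "asker H a = ask (Node (enc_nat a) (Node (enc_rev (skipped H a)) (enc_rev (partners H a))))"

lemma tsize_enc_rev [simp]: "tsize (enc_rev A) = tsize (enc_set A)"
  by (simp add: enc_rev_def enc_set_def)

lemma tsize_enc_setting:
  "tsize (enc_set (refugees H)) \<le> tsize (enc_setting H)"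
  "tsize (enc_set (inhabitants H)) \<le> tsize (enc_setting H)"
  "tsize (enc_set {}) \<le> tsize (enc_setting H)"
  by (simp_all add: enc_setting_def, simp add: enc_set_def)

lemma tsize_skipped_partners:
  "tsize (enc_set (skipped H a)) \<le> tsize (enc_setting H)"
  "tsize (enc_set (partners H a)) \<le> tsize (enc_setting H)"
  using tsize_enc_setting by (auto simp: skipped_def partners_def)

lemma tsize_enc_nat_le:
  assumes "finite A" "a \<in> A"
  shows "tsize (enc_nat a) \<le> tsize (enc_set A)"
  unfolding enc_set_def using assms by (intro tsize_nth_le) simp

lemma tsize_agent_le:
  assumes "wf_setting H" "a \<in> agents H"
  shows "tsize (enc_nat a) \<le> tsize (enc_setting H)"
  using assms tsize_enc_nat_le tsize_enc_setting
  unfolding agents_def wf_setting_def by (metis Un_iff le_trans)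

lemma enc_set_inject: "finite A \<Longrightarrow> finite B \<Longrightarrow> enc_set A = enc_set B \<longleftrightarrow> A = B"
  by (auto simp: enc_set_def inj_map_eq_map inj_def dest: sorted_list_of_set_inject)

section \<open>Correctness and running time of the oracle procedures\<close>

lemma hedonic_oracle_iff:
  assumes H: "hedonic_instance H" and a: "a \<in> agents H" and "finite S"
  shows "hedonic_oracle H (Node (enc_nat a) (enc_set S)) \<longleftrightarrow> S \<in> approved_sets H a"
proof -
  \<comment> \<open>\<open>enc_set\<close> is injective on finite sets only, since an infinite set
    is encoded like the empty one.\<close>
  have "finite S'" if "S' \<in> approved_sets H a" for S'
    using H a that unfolding hedonic_instance_def wf_setting_def agents_def
    by (meson PowD UnE finite_subset in_mono)
  then show ?thesis
    using a enc_set_inject[OF \<open>finite S\<close>] by (auto simp: hedonic_oracle_def)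
qed

text \<open>A fraction vanishes iff its numerator does, and the binary code of a number is
  \<open>Leaf\<close> only for 0. This justifies the test in \<open>collect_body\<close>.\<close>

lemma numerator_enc_rat: "right (left (enc_rat x)) \<noteq> Leaf \<longleftrightarrow> x \<noteq> 0"
proof -
  obtain n d where nd: "quotient_of x = (n, d)" by fastforce
  then have "x = of_int n / of_int d" "d > 0"
    using quotient_of_div quotient_of_denom_pos by blast+
  then show ?thesis using nd by (simp add: enc_rat_def enc_int_def)
qed

text \<open>Shows that the collected names form the sorted list that \<open>enc_set\<close>
  prescribes, which is the form of query the oracle recognizes.\<close>

lemma filter_sorted_list_of_set:
  assumes "finite A"
  shows "filter (\<lambda>x. x \<in> S) (sorted_list_of_set A) = sorted_list_of_set (S \<inter> A)"
  using assms
  by (intro sorted_distinct_set_unique) (auto intro: sorted_filter[where f = "\<lambda>x. x", simplified])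

lemma asker_computes:
  assumes H: "hedonic_instance H" and a: "a \<in> agents H" and S: "S \<subseteq> agents H"
  defines "q \<equiv> palette (types (red H)) S"
  shows "computes_within (hedonic_oracle H) (asker H a) (enc_palette q)
    (enc_bool (q \<in> approved_palettes (red H) a))
    (12 * ask_weight * (tsize (enc_setting H) + tsize (enc_palette q)) ^ 3)"
proof -
  have wf: "wf_setting H" using H by (simp add: hedonic_instance_def)
  have finS: "finite S" using S type_order_set(3)[OF wf] finite_subset by blast
  have fin: "finite (partners H a)" using wf by (simp add: partners_def wf_setting_def)
  define N where "N = tsize (enc_setting H) + tsize (enc_palette q)"
  define us where "us = rev (map enc_nat (sorted_list_of_set (skipped H a)))"
  define l where "l = rev (sorted_list_of_set (partners H a))"
  define c where "c = Node (enc_nat a) (Node (enc_list us) (enc_list (map enc_nat l)))"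
  define ps where "ps = map enc_rat q"
  have q: "q = palette (map (\<lambda>a. {a}) (type_order H)) S" by (simp add: q_def)
  have len: "length ps = length (type_order H)" by (simp add: ps_def q palette_def)
  have bound: "length us + length l \<le> length ps"
    using wf unfolding len by (auto simp: us_def l_def type_order_def skipped_def partners_def)
  \<comment> \<open>For an inhabitant \<open>l\<close> is the second block of
    \<open>type_order\<close>, reached after skipping the first; for a refugee it is the first block
    and \<open>us\<close> is empty.\<close>
  have "type_order H ! (length us + i) = l ! i" if "i < length l" for i
    using that by (auto simp: type_order_def us_def l_def skipped_def partners_def nth_append)
  then have mem_S: "right (left (ps ! (length us + i))) \<noteq> Leaf \<longleftrightarrow> l ! i \<in> S"
    if "i < length l" for i
    using that bound len nth_palette_eq_0_iff[OF finS, of "length us + i" "type_order H"]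
    by (simp add: ps_def numerator_enc_rat q)
  have us_l: "tsize (enc_list us) \<le> tsize (enc_setting H)"
      "tsize (enc_list (map enc_nat l)) \<le> tsize (enc_setting H)"
    using tsize_skipped_partners[of H a]
    by (simp_all add: us_def l_def enc_set_def flip: rev_map)
  then have steps: "length us + length l + 1 \<le> 3 * N"
    using length_le_tsize[of us] length_le_tsize[of "map enc_nat l"] tsize_pos[of "enc_palette q"]
    by (simp add: N_def)
  have cN: "tsize c \<le> 4 * N"
    using us_l tsize_agent_le[OF wf a] tsize_pos[of "enc_palette q"] by (simp add: c_def N_def)
  have psN: "tsize (enc_list ps) \<le> 4 * N"
    by (simp add: ps_def enc_palette_def N_def)
  obtain s n where s: "exec (hedonic_oracle H) (ask c) ((\<lambda>_. Leaf)(0 := enc_list ps)) n s"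
      "n \<le> ((length us + length l + 1) * ask_weight) * (4 * N)"
      "s 0 = enc_bool (hedonic_oracle H
         (Node (enc_nat a) (enc_list (map enc_nat (filter (\<lambda>x. x \<in> S) (rev l))))))"
    using runs_ask[OF bound mem_S c_def psN cN] unfolding runs_def by blast
  have "enc_list (map enc_nat (filter (\<lambda>x. x \<in> S) (rev l))) = enc_set (S \<inter> partners H a)"
    by (simp add: l_def enc_set_def filter_sorted_list_of_set[OF fin])
  then have result: "s 0 = enc_bool (q \<in> approved_palettes (red H) a)"
    using s(3) hedonic_oracle_iff[OF H a] finS approved_palettes_red[OF wf S]
    by (simp add: q_def)
  have "n \<le> (3 * N * ask_weight) * (4 * N)"
    using s(2) steps by (meson le_trans mult_le_mono1)
  also have "\<dots> = 12 * ask_weight * N ^ 2" by (simp add: power2_eq_square)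
  \<comment> \<open>A quadratic bound holds already; the cube lets the procedures share one monomial
    with the reduction.\<close>
  also have "\<dots> \<le> 12 * ask_weight * N ^ 3"
    using tsize_pos[of "enc_palette q"]
    by (intro mult_le_mono2 power_increasing) (auto simp: N_def)
  finally have time: "n \<le> 12 * ask_weight * N ^ 3" .
  have "asker H a = ask c" by (simp add: asker_def c_def enc_rev_def us_def l_def rev_map)
  then show ?thesis
    using s(1) result time unfolding computes_within_def ps_def enc_palette_def N_def by auto
qed

section \<open>The program that computes the reduction\<close>

definition quoted_ask :: "exp \<Rightarrow> exp" where
  "quoted_ask e =
     Join (Const (enc_nat 3))
       (Join (Join (Const (enc_nat 1)) (Join (Const (enc_nat 1)) (Join (Const (enc_nat 1)) e)))
         (Const (enc_com ask_code)))"

text \<open>The numbers 3, 1, 1, 1 in \<open>quoted_ask\<close> are the tag of \<open>Seq\<close>,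
  the tag of \<open>Assign\<close>, the assigned variable and the tag of \<open>Const\<close>. The
  text of \<open>ask_code\<close> is a literal.\<close>

lemma eval_quoted_ask [simp]: "eval_exp (quoted_ask e) s = enc_com (ask (eval_exp e s))"
  by (simp add: quoted_ask_def ask_def)

text \<open>The constant occurs once in the program text, so the overhead is fixed.\<close>

lemma tsize_ask: "tsize (enc_com (ask t)) \<le> tsize (enc_com (ask Leaf)) + tsize t"
  by (simp add: ask_def)

text \<open>This and \<open>inh_exp\<close> select the third and fourth component of
  \<open>enc_setting\<close>.\<close>

definition ref_exp :: exp where "ref_exp = Fst (Snd (Snd (Var 0)))"

definition inh_exp :: exp where "inh_exp = Fst (Snd (Snd (Snd (Var 0))))"

text \<open>A name followed by \<open>Leaf\<close> is a one-element list, hence the encoding of a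
  singleton type.\<close>

definition type_exp :: exp where "type_exp = Join (Fst (Var 1)) (Const Leaf)"

text \<open>A table entry: the agent as key, then its program. Variable 3 holds the reversed
  inhabitants; the \<open>Leaf\<close> before it says that a refugee skips nothing.\<close>

definition ref_proc_exp :: exp where
  "ref_proc_exp = Join (Fst (Var 1)) (quoted_ask (Join (Fst (Var 1)) (Join (Const Leaf) (Var 3))))"

definition inh_proc_exp :: exp where
  "inh_proc_exp = Join (Fst (Var 1)) (quoted_ask (Join (Fst (Var 1)) (Join (Var 3) (Var 2))))"

definition out_exp :: exp where
  "out_exp = Join (Var 0) (Join (Var 4) (Join (Var 5) (Join (Var 6) (Const Leaf))))"

text \<open>Refugee types are pushed before inhabitant types, so the inhabitants end up in front as
  in \<open>type_order\<close>. The tables of procedures are built from the reversed lists and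
  therefore come out in the increasing order of \<open>enc_map\<close>.\<close>

definition reducer :: com where
  "reducer =
     Seq (push_loop ref_exp 2 (Fst (Var 1)))
    (Seq (push_loop inh_exp 3 (Fst (Var 1)))
    (Seq (push_loop ref_exp 4 type_exp)
    (Seq (push_loop inh_exp 4 type_exp)
    (Seq (push_loop (Var 2) 5 ref_proc_exp)
    (Seq (push_loop (Var 3) 6 inh_proc_exp)
         (Assign 0 out_exp))))))"

definition reducer_weight :: nat where
  "reducer_weight =
     push_weight ref_exp 2 (Fst (Var 1)) + (push_weight inh_exp 3 (Fst (Var 1)) +
    (push_weight ref_exp 4 type_exp + (push_weight inh_exp 4 type_exp +
    (push_weight (Var 2) 5 ref_proc_exp + (push_weight (Var 3) 6 inh_proc_exp +
     step_weight out_exp)))))"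

text \<open>The 2 absorbs the \<open>Suc\<close> in the step count; the last factor is the
  coefficient of the quadratic bound on the stores.\<close>

definition reducer_factor :: nat where
  "reducer_factor = 2 * reducer_weight * (10 + tsize (enc_com (ask Leaf)))"

text \<open>Stated for arbitrary lists \<open>rs\<close> and \<open>hs\<close> to keep the instance
  out of the analysis of the loops. The only other intermediate list, that of the refugee types, is
  a suffix of \<open>T\<close>.\<close>

lemma runs_reducer:
  assumes x: "left (right (right x)) = enc_list rs" "left (right (right (right x))) = enc_list hs"
    and K: "tsize x \<le> K" "tsize (enc_list rs) \<le> K" "tsize (enc_list hs) \<le> K"
    and fr: "\<And>t. fr t = Node t (enc_com (ask (Node t (Node Leaf (enc_list (rev hs))))))"
    and fh: "\<And>t. fh t = Node t (enc_com (ask (Node t (Node (enc_list (rev hs)) (enc_list (rev rs))))))"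
    and T: "T = map (\<lambda>t. Node t Leaf) (rev hs) @ map (\<lambda>t. Node t Leaf) (rev rs)"
    and K': "tsize (enc_list T) \<le> K" "tsize (enc_list (map fr rs)) \<le> K"
      "tsize (enc_list (map fh hs)) \<le> K"
    and n: "length rs \<le> n" "length hs \<le> n"
  shows "\<exists>s. runs Q K reducer ((\<lambda>_. Leaf)(0 := x)) (Suc n * reducer_weight) s \<and>
    s 0 = enc_list [x, enc_list T, enc_list (map fr rs), enc_list (map fh hs)]"
proof -
  let ?r = "enc_list (rev rs)" and ?h = "enc_list (rev hs)"
  let ?t = "enc_list (map (\<lambda>t. Node t Leaf) (rev rs))"
  have K1: "1 \<le> K" using K(1) tsize_pos le_trans by blast
  have t: "tsize ?t \<le> K"
    using K'(1) tsize_enc_list_append_le(2) unfolding T by (rule le_trans[rotated])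
  note mem_simps = bounded_mem mem_upd mem_apply
  let ?s1 = "mem [x, Leaf, ?r, Leaf, Leaf, Leaf, Leaf]"
  let ?s2 = "mem [x, Leaf, ?r, ?h, Leaf, Leaf, Leaf]"
  let ?s3 = "mem [x, Leaf, ?r, ?h, ?t, Leaf, Leaf]"
  let ?s4 = "mem [x, Leaf, ?r, ?h, enc_list T, Leaf, Leaf]"
  let ?s5 = "mem [x, Leaf, ?r, ?h, enc_list T, enc_list (map fr rs), Leaf]"
  let ?s6 = "mem [x, Leaf, ?r, ?h, enc_list T, enc_list (map fr rs), enc_list (map fh hs)]"
  have init: "(\<lambda>_. Leaf)(0 := x) = mem [x, Leaf, Leaf, Leaf, Leaf, Leaf, Leaf]"
    unfolding mem_init[of _ 6] by (simp add: eval_nat_numeral)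
  have 1: "runs Q K (push_loop ref_exp 2 (Fst (Var 1))) ((\<lambda>_. Leaf)(0 := x))
      (Suc (length rs) * push_weight ref_exp 2 (Fst (Var 1))) ?s1"
    unfolding init by (rule runs_push_loop[where f = "\<lambda>t. t" and us = "[]" and ts = rs])
      (use x K K1 in \<open>auto simp: mem_simps ref_exp_def\<close>)
  have 2: "runs Q K (push_loop inh_exp 3 (Fst (Var 1))) ?s1
      (Suc (length hs) * push_weight inh_exp 3 (Fst (Var 1))) ?s2"
    by (rule runs_push_loop[where f = "\<lambda>t. t" and us = "[]" and ts = hs])
      (use x K K1 in \<open>auto simp: mem_simps inh_exp_def\<close>)
  have 3: "runs Q K (push_loop ref_exp 4 type_exp) ?s2
      (Suc (length rs) * push_weight ref_exp 4 type_exp) ?s3"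
    by (rule runs_push_loop[where f = "\<lambda>t. Node t Leaf" and us = "[]" and ts = rs])
      (use x K K1 t in \<open>auto simp: mem_simps ref_exp_def type_exp_def\<close>)
  have 4: "runs Q K (push_loop inh_exp 4 type_exp) ?s3
      (Suc (length hs) * push_weight inh_exp 4 type_exp) ?s4"
    by (rule runs_push_loop[where f = "\<lambda>t. Node t Leaf" and ts = hs
          and us = "map (\<lambda>t. Node t Leaf) (rev rs)"])
      (use x K K1 t K'(1) T in \<open>auto simp: mem_simps inh_exp_def type_exp_def\<close>)
  have 5: "runs Q K (push_loop (Var 2) 5 ref_proc_exp) ?s4
      (Suc (length (rev rs)) * push_weight (Var 2) 5 ref_proc_exp) ?s5"
    by (rule runs_push_loop[where f = fr and us = "[]" and ts = "rev rs"])
      (use x K K1 K' in \<open>auto simp: mem_simps ref_proc_exp_def fr\<close>)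
  have 6: "runs Q K (push_loop (Var 3) 6 inh_proc_exp) ?s5
      (Suc (length (rev hs)) * push_weight (Var 3) 6 inh_proc_exp) ?s6"
    by (rule runs_push_loop[where f = fh and us = "[]" and ts = "rev hs"])
      (use x K K1 K' in \<open>auto simp: mem_simps inh_proc_exp_def fh\<close>)
  let ?out = "?s6(0 := enc_list [x, enc_list T, enc_list (map fr rs), enc_list (map fh hs)])"
  have 7: "runs Q K (Assign 0 out_exp) ?s6 (step_weight out_exp) ?out"
    by (rule runs_Assign) (use K K1 K' in \<open>auto simp: mem_simps out_exp_def\<close>)
  have "runs Q K reducer ((\<lambda>_. Leaf)(0 := x)) (Suc n * reducer_weight) ?out"
    unfolding reducer_def
    by (rule runs_mono[OF runs_Seq[OF 1 runs_Seq[OF 2 runs_Seq[OF 3 runs_Seq[OF 4 runs_Seq[OF 5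
          runs_Seq[OF 6 7]]]]]]])
      (unfold reducer_weight_def add_mult_distrib2, intro add_mono mult_le_mono1,
        use n in auto)
  then show ?thesis by (intro exI[of _ ?out]) simp
qed

lemma reducer_computes:
  assumes H: "hedonic_instance H"
  shows "computes_within (hedonic_oracle H) reducer (enc_setting H)
    (enc_diversity (red H) (asker H)) (reducer_factor * tsize (enc_setting H) ^ 3)"
proof -
  have wf: "wf_setting H" using H by (simp add: hedonic_instance_def)
  define N where "N = tsize (enc_setting H)"
  define D where "D = tsize (enc_com (ask Leaf))"
  \<comment> \<open>The largest values are the tables of procedures: at most \<open>N\<close>
    entries, each linear in \<open>N\<close> with additive constant \<open>D\<close>.\<close>
  define K where "K = (10 + D) * N\<^sup>2"
  define rs where "rs = map enc_nat (sorted_list_of_set (refugees H))"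
  define hs where "hs = map enc_nat (sorted_list_of_set (inhabitants H))"
  define fr where "fr t = Node t (enc_com (ask (Node t (Node Leaf (enc_list (rev hs))))))" for t
  define fh where
    "fh t = Node t (enc_com (ask (Node t (Node (enc_list (rev hs)) (enc_list (rev rs))))))" for t
  define T where "T = map (\<lambda>t. Node t Leaf) (rev hs) @ map (\<lambda>t. Node t Leaf) (rev rs)"
  have N1: "1 \<le> N" unfolding N_def by (rule tsize_pos)
  have sizes: "tsize (enc_list rs) \<le> N" "tsize (enc_list hs) \<le> N"
    using tsize_enc_setting[of H] by (simp_all add: rs_def hs_def N_def enc_set_def)
  have lens: "length rs \<le> N" "length hs \<le> N"
    using sizes length_le_tsize le_trans by blast+
  have elems: "tsize t \<le> N" if "t \<in> set rs \<union> set hs" for t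
    using that sizes tsize_nth_le le_trans by blast
  have K_eq: "K = 10 * (N * N) + D * (N * N)"
    by (simp add: K_def power2_eq_square algebra_simps)
  have N2: "N \<le> N * N" "1 \<le> N * N" "D * N \<le> D * (N * N)"
    using N1 by auto
  \<comment> \<open>The name occurs twice, as key and inside the program, next to at most two group
    lists; this gives \<open>4 * N\<close>.\<close>
  have f: "tsize (fr t) \<le> 4 * N + D + 4" "tsize (fh t) \<le> 4 * N + D + 4"
    if "t \<in> set rs \<union> set hs" for t
    using elems[OF that] sizes N1
      tsize_ask[of "Node t (Node Leaf (enc_list (rev hs)))"]
      tsize_ask[of "Node t (Node (enc_list (rev hs)) (enc_list (rev rs)))"]
    by (simp_all add: fr_def fh_def D_def)
  have list: "tsize (enc_list ts) \<le> K"
    if "\<And>t. t \<in> set ts \<Longrightarrow> tsize t \<le> 4 * N + D + 4" "length ts \<le> N" for ts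
  proof -
    have "tsize (enc_list ts) \<le> 1 + length ts * (1 + (4 * N + D + 4))"
      by (rule tsize_enc_list_bound) (use that in auto)
    also have "\<dots> \<le> 1 + N * (1 + (4 * N + D + 4))" using that(2) by simp
    also have "\<dots> = 1 + 5 * N + D * N + 4 * (N * N)" by (simp add: algebra_simps)
    also have "\<dots> \<le> K" using N2 unfolding K_eq by linarith
    finally show ?thesis .
  qed
  have procs_le: "tsize (enc_list (map fr rs)) \<le> K" "tsize (enc_list (map fh hs)) \<le> K"
    by (rule list; use f lens in auto)+
  have T_le: "tsize (enc_list T) \<le> K"
  proof -
    have "tsize (enc_list T) \<le> 1 + length T * (1 + (N + 2))"
      by (rule tsize_enc_list_bound) (use elems in \<open>auto simp: T_def\<close>)
    also have "\<dots> \<le> 1 + (2 * N) * (1 + (N + 2))"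
      using lens by (intro add_left_mono mult_le_mono1) (simp add: T_def)
    also have "\<dots> = 1 + 6 * N + 2 * (N * N)" by (simp add: algebra_simps)
    also have "\<dots> \<le> K" using N2 unfolding K_eq by linarith
    finally show ?thesis .
  qed
  have NK: "N \<le> K" using N2 unfolding K_eq by linarith
  have x: "left (right (right (enc_setting H))) = enc_list rs"
    "left (right (right (right (enc_setting H)))) = enc_list hs"
    by (simp_all add: enc_setting_def enc_set_def rs_def hs_def)
  have "\<exists>s. runs (hedonic_oracle H) K reducer ((\<lambda>_. Leaf)(0 := enc_setting H))
      (Suc N * reducer_weight) s \<and>
    s 0 = enc_list [enc_setting H, enc_list T, enc_list (map fr rs), enc_list (map fh hs)]"
    by (rule runs_reducer[OF x _ _ _ fr_def fh_def T_def T_le procs_le lens])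
      (use sizes NK in \<open>auto simp: N_def[symmetric]\<close>)
  then obtain s n where s: "exec (hedonic_oracle H) reducer ((\<lambda>_. Leaf)(0 := enc_setting H)) n s"
      "n \<le> (Suc N * reducer_weight) * K"
      "s 0 = enc_list [enc_setting H, enc_list T, enc_list (map fr rs), enc_list (map fh hs)]"
    unfolding runs_def by blast
  have fin: "finite (refugees H)" "finite (inhabitants H)" "refugees H \<inter> inhabitants H = {}"
    using wf by (auto simp: wf_setting_def)
  have "enc_list T = enc_list (map enc_set (types (red H)))"
    by (simp add: T_def rs_def hs_def type_order_def enc_set_def rev_map)
  \<comment> \<open>Disjointness of the groups sends every refugee into the second branch of
    \<open>skipped\<close> and \<open>partners\<close>.\<close>
  moreover have "enc_list (map fr rs) = enc_map (\<lambda>r. enc_com (asker H r)) (refugees (red H))"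
    using fin by (auto simp: enc_map_def rs_def hs_def fr_def asker_def skipped_def partners_def
        enc_rev_def)
  moreover have "enc_list (map fh hs) = enc_map (\<lambda>h. enc_com (asker H h)) (inhabitants (red H))"
    using fin by (auto simp: enc_map_def rs_def hs_def fh_def asker_def skipped_def partners_def
        enc_rev_def)
  ultimately have out: "s 0 = enc_diversity (red H) (asker H)"
    using s(3) by (simp add: enc_diversity_def)
  have "n \<le> (2 * N * reducer_weight) * K"
    using s(2) N1 by (elim le_trans) (intro mult_le_mono1, simp)
  also have "\<dots> = reducer_factor * N ^ 3"
    by (simp add: K_def D_def reducer_factor_def power2_eq_square power3_eq_cube algebra_simps)
  finally show ?thesis
    using s(1) out unfolding computes_within_def N_def by blast
qed

lemma poly_time_reduction_red: "poly_time_reduction red"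
  unfolding poly_time_reduction_def
\<comment> \<open>Both time bounds are cubic, so the monomial with the sum of their coefficients
  dominates each of them.\<close>
proof (intro exI[of _ reducer] exI[of _ "monom (reducer_factor + 12 * ask_weight) 3"] allI impI)
  fix H assume H: "hedonic_instance H"
  have mono: "computes_within Q c x y b" if "computes_within Q c x y b'" "b' \<le> b" for Q c x y b b'
    using that unfolding computes_within_def by (blast intro: le_trans)
  show "\<exists>proc.
      computes_within (hedonic_oracle H) reducer (enc_setting H) (enc_diversity (red H) proc)
        (poly (monom (reducer_factor + 12 * ask_weight) 3) (tsize (enc_setting H))) \<and>
      (\<forall>a\<in>agents (red H). \<forall>q\<in>palette (types (red H)) ` Pow (agents (red H)).
         computes_within (hedonic_oracle H) (proc a) (enc_palette q)
           (enc_bool (q \<in> approved_palettes (red H) a))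
           (poly (monom (reducer_factor + 12 * ask_weight) 3)
             (tsize (enc_setting H) + tsize (enc_palette q))))"
  proof (intro exI[of _ "asker H"] conjI ballI)
    show "computes_within (hedonic_oracle H) reducer (enc_setting H) (enc_diversity (red H) (asker H))
        (poly (monom (reducer_factor + 12 * ask_weight) 3) (tsize (enc_setting H)))"
      by (rule mono[OF reducer_computes[OF H]]) (simp add: poly_monom)
    fix a q
    assume a: "a \<in> agents (red H)" and q: "q \<in> palette (types (red H)) ` Pow (agents (red H))"
    from q obtain S where "S \<subseteq> agents H" "q = palette (types (red H)) S" by auto
    then show "computes_within (hedonic_oracle H) (asker H a) (enc_palette q)
        (enc_bool (q \<in> approved_palettes (red H) a))
        (poly (monom (reducer_factor + 12 * ask_weight) 3)
          (tsize (enc_setting H) + tsize (enc_palette q)))"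
      using mono[OF asker_computes[OF H]] a by (simp add: poly_monom)
  qed
qed

theorem theorem5p3:
  shows "\<exists>red :: hedonic \<Rightarrow> diversity.
    poly_time_reduction red \<and>
    (\<forall>H. hedonic_instance H \<longrightarrow>
       diversity_instance (red H) \<and>
       setting.truncate (red H) = setting.truncate H \<and>
       length (types (red H)) = card (refugees H) + card (inhabitants H) \<and>
       (hedonic_yes H \<longleftrightarrow> diversity_yes (red H)))"
proof (intro exI[of _ red] conjI allI impI)
  fix H assume "hedonic_instance H"
  then have wf: "wf_setting H" by (simp add: hedonic_instance_def)
  show "diversity_instance (red H)" by (rule diversity_instance_red[OF wf])
  show "setting.truncate (red H) = setting.truncate H" by simp
  show "length (types (red H)) = card (refugees H) + card (inhabitants H)"
    using type_order_set(4)[OF wf] by simp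
  show "hedonic_yes H \<longleftrightarrow> diversity_yes (red H)" by (rule hedonic_yes_iff_diversity_yes[OF wf])
qed (rule poly_time_reduction_red)

end
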